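(* Consider a balanced generalized Pólya urn with replacement matrix $R=\begin{pmatrix} a & b \\ c & d \end{pmatrix}$, composition $U_n$ at time $n$, and $S=a+b=c+d$, $m=a-c=d-b$, $\sigma=m/S$, $v_1=\frac{S}{b+c}\begin{pmatrix} c \\ b \end{pmatrix}$. Assume that the urn is small, i.e. $\sigma<1/2$, and that $bc\neq0$. Then $$\frac{U_n-nv_1}{\sqrt n}\;\xrightarrow[n\to\infty]{\mathcal{L}}\;\mathcal{N}(0,\Gamma),\qquad \Gamma=\frac{1}{1-2\sigma}\,\frac{bcm^2}{(b+c)^2}\begin{pmatrix} 1 & -1 \\ -1 & 1 \end{pmatrix},$$ where $\xrightarrow{\mathcal{L}}$ denotes convergence in distribution and $\mathcal{N}(0,\Gamma)$ is the (degenerate) centered Gaussian law on $\mathbb{R}^2$ with covariance matrix $\Gamma$.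
   Context: Generalized Pólya urn model: $a,b,c,d$ are nonnegative integers, the replacement matrix $R$ is not diagonal ($b+c\ge1$), and the urn is balanced: $a+b=c+d=S\ge1$. At time $0$ the urn contains $\alpha\ge0$ red balls and $\beta\ge0$ white balls ($\alpha,\beta$ integers), with $\tau=\alpha+\beta\ge1$. At each time $n\ge1$ one ball is drawn uniformly at random from the urn and its color observed. If it is red, it is returned together with $a$ additional red balls and $b$ additional white balls; if it is white, it is returned together with $c$ additional red balls and $d$ additional white balls. $U_n=(X_n,Y_n)^T$, where $X_n$ and $Y_n$ are the numbers of red and white balls at time $n$; $U_0=(\alpha,\beta)^T$ and $X_n+Y_n=\tau_n=\tau+nS$. Equivalently, $U_{n+1}=U_n+R^T(\varepsilon_{n+1},1-\varepsilon_{n+1})^T$, where the conditional distribution of $\varepsilon_{n+1}$ given the past $\mathcal{F}_n$ up to time $n$ is Bernoulli with parameter $X_n/\tau_n$. *)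

theory Defs
  imports "HOL-Probability.Probability"
begin

definition replacement_matrix :: "nat \<Rightarrow> nat \<Rightarrow> nat \<Rightarrow> nat \<Rightarrow> real^2^2" where
  "replacement_matrix a b c d = vector [vector [real a, real b], vector [real c, real d]]"

text \<open>
  \<open>red n\<close> is the event that the ball drawn at time \<open>n \<ge> 1\<close> is red, i.e. \<open>\<epsilon>\<^sub>n = of_bool (red n)\<close>
  (\<open>red 0\<close> is irrelevant); \<open>U n $ 1\<close> and \<open>U n $ 2\<close> are the numbers of red and white balls at
  time \<open>n\<close>. The past up to time \<open>n\<close> is given by an arbitrary filtration \<open>F\<close> to which the draws
  are adapted, for instance the one they generate.
\<close>

locale balanced_polya_urn = prob_space M + filtration "space M" F
  for M :: "'a measure" and F :: "nat \<Rightarrow> 'a measure" +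
  fixes a b c d S \<alpha> \<beta> :: nat
    and red :: "nat \<Rightarrow> 'a \<Rightarrow> bool"
    and U :: "nat \<Rightarrow> 'a \<Rightarrow> real^2"
  assumes not_diagonal: "b + c \<ge> 1"
    and balanced: "a + b = S" "c + d = S"
    and S_ge_1: "S \<ge> 1"
    and initial_nonempty: "\<alpha> + \<beta> \<ge> 1"
    and subalgebra_F: "\<And>n. subalgebra M (F n)"
    and red_adapted: "\<And>n. red (Suc n) \<in> measurable (F (Suc n)) (count_space UNIV)"
    and U_0: "\<And>\<omega>. \<omega> \<in> space M \<Longrightarrow> U 0 \<omega> = vector [real \<alpha>, real \<beta>]"
    and U_Suc: "\<And>n \<omega>. \<omega> \<in> space M \<Longrightarrow>
      U (Suc n) \<omega> = U n \<omega> + transpose (replacement_matrix a b c d) *v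
        vector [of_bool (red (Suc n) \<omega>), 1 - of_bool (red (Suc n) \<omega>)]"
    and draw_uniform: "\<And>n. AE \<omega> in M.
      real_cond_exp M (F n) (\<lambda>\<omega>. of_bool (red (Suc n) \<omega>)) \<omega> = U n \<omega> $ 1 / real (\<alpha> + \<beta> + n * S)"

text \<open>
  Gaussian laws are specified by their characteristic function, so that singular covariance
  matrices (for which there is no density) are included.
\<close>

definition gaussian_law :: "real^'n::finite \<Rightarrow> real^'n^'n \<Rightarrow> (real^'n) measure \<Rightarrow> bool" where
  "gaussian_law \<mu> \<Gamma> N \<longleftrightarrow> prob_space N \<and> sets N = sets borel \<and>
    (\<forall>u. (LINT x|N. iexp (u \<bullet> x)) = exp (\<i> * of_real (u \<bullet> \<mu>) - of_real (u \<bullet> (\<Gamma> *v u)) / 2))"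

text \<open>The library's \<open>weak_conv_m\<close> only covers measures on the real line.\<close>

definition converges_weakly ::
    "(nat \<Rightarrow> 'b::topological_space measure) \<Rightarrow> 'b measure \<Rightarrow> bool" where
  "converges_weakly \<mu> \<nu> \<longleftrightarrow>
    (\<forall>f :: 'b \<Rightarrow> real. continuous_on UNIV f \<longrightarrow> bounded (range f) \<longrightarrow>
      (\<lambda>n. LINT x|\<mu> n. f x) \<longlonglongrightarrow> (LINT x|\<nu>. f x))"

definition converges_in_distribution ::
    "'a measure \<Rightarrow> (nat \<Rightarrow> 'a \<Rightarrow> 'b::topological_space) \<Rightarrow> 'b measure \<Rightarrow> bool" where
  "converges_in_distribution M Z \<nu> \<longleftrightarrow> converges_weakly (\<lambda>n. distr M borel (Z n)) \<nu>"

end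

theory Submission
  imports Defs "HOL-Real_Asymp.Real_Asymp"
begin

text \<open>
  Let \<open>p = c / (b + c)\<close> and let \<open>\<tau>\<^sub>n\<close> be the number of balls at time \<open>n\<close>. The centred number of red balls
  \<open>W\<^sub>n = X\<^sub>n - p \<tau>\<^sub>n\<close> satisfies \<open>W\<^sub>n\<^sub>+\<^sub>1 = W\<^sub>n + m (\<epsilon>\<^sub>n\<^sub>+\<^sub>1 - p)\<close>, where \<open>\<epsilon>\<^sub>n\<^sub>+\<^sub>1 - p\<close> has conditional mean
  \<open>W\<^sub>n / \<tau>\<^sub>n\<close>. Expanding \<open>exp (\<i> \<theta> m (\<epsilon>\<^sub>n\<^sub>+\<^sub>1 - p))\<close> to second order gives, for the characteristic
  functions \<open>f\<^sub>n\<close> of \<open>W\<^sub>n\<close>,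
  \<open>f\<^sub>n\<^sub>+\<^sub>1(\<theta>) \<approx> f\<^sub>n(\<theta> (1 + m / \<tau>\<^sub>n)) exp (- \<theta>\<^sup>2 m\<^sup>2 p (1 - p) / 2)\<close>.
  At \<open>\<theta> = t / sqrt (n + 1)\<close> the Gaussian with variance \<open>m\<^sup>2 p (1 - p) / (1 - 2 \<sigma>)\<close> is a fixed point of
  this recursion up to \<open>o(1/n)\<close>, and for \<open>\<sigma> < 1/2\<close> the recursion contracts towards it. The vector
  \<open>U\<^sub>n - n v\<^sub>1\<close> differs from \<open>W\<^sub>n (1, -1)\<close> by a constant.
\<close>

section \<open>Scalar recursions with contraction factor close to 1 - \<open>\<delta>\<close> /
  n\<close>

text \<open>The product of the factors 1 - k/n decays like n to the power -k, so any starting value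
  is forgotten. A source term of size o(1/n) is eventually too weak to hold the sequence above a
  given positive level.\<close>

lemma contraction_tendsto_0:
  fixes y \<rho> e :: "nat \<Rightarrow> real"
  assumes step: "\<forall>\<^sub>F n in sequentially. y (Suc n) \<le> \<rho> n * y n + e n"
    and nonneg: "\<And>n. 0 \<le> y n"
    and \<rho>: "(\<lambda>n. real n * (1 - \<rho> n)) \<longlonglongrightarrow> \<delta>" and \<delta>: "\<delta> > 0"
    and e: "(\<lambda>n. real n * e n) \<longlonglongrightarrow> 0"
  shows "y \<longlonglongrightarrow> 0"
proof (rule LIMSEQ_I)
  fix r :: real assume r: "r > 0"
  \<comment> \<open>Halving \<open>\<delta>\<close> leaves room for
    \<open>\<rho> n \<le> 1 - k / n\<close> eventually. Half of \<open>r\<close> is spent on the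
    level \<open>\<epsilon>\<close>, the other half on the excess above it.\<close>
  define k where "k = \<delta> / 2"
  define \<epsilon> where "\<epsilon> = r / 2"
  have k: "k > 0" and \<epsilon>: "\<epsilon> > 0" using \<delta> r by (auto simp: k_def \<epsilon>_def)
  have "\<forall>\<^sub>F n in sequentially. k < real n * (1 - \<rho> n)"
    by (rule order_tendstoD(1)[OF \<rho>]) (use \<delta> in \<open>simp add: k_def\<close>)
  moreover have "\<forall>\<^sub>F n in sequentially. real n * e n < \<epsilon> * k"
    by (rule order_tendstoD(2)[OF e]) (use k \<epsilon> in simp)
  ultimately have "\<forall>\<^sub>F n in sequentially. y (Suc n) \<le> \<rho> n * y n + e n \<and> k < real n * (1 - \<rho> n)
      \<and> real n * e n < \<epsilon> * k \<and> n > k \<and> n > 0"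
    using step eventually_gt_at_top[of "0::nat"] eventually_gt_at_top[of "nat \<lceil>k\<rceil>"]
    by eventually_elim (auto simp: nat_ceiling_le_eq intro: le_less_trans[OF of_nat_ceiling])
  then obtain n0 where n0: "\<And>n. n \<ge> n0 \<Longrightarrow> y (Suc n) \<le> \<rho> n * y n + e n \<and> k < real n * (1 - \<rho> n)
      \<and> real n * e n < \<epsilon> * k \<and> n > k \<and> n > 0"
    by (auto simp: eventually_sequentially)
  \<comment> \<open>The level \<open>\<epsilon>\<close> is the fixed point of the map sending x to
    (1 - k/n) x + \<open>\<epsilon>\<close> k/n, which dominates the recursion. The excess over it
    therefore contracts with no source term.\<close>
  define z where "z n = max 0 (y n - \<epsilon>)" for n
  have z0: "z n \<ge> 0" for n by (simp add: z_def)
  have zs: "z (Suc n) \<le> (1 - k / n) * z n" if n: "n \<ge> n0" for n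
  proof -
    have n1: "n > 0" "real n > k" and "k < real n * (1 - \<rho> n)" "real n * e n < \<epsilon> * k"
      using n0[OF n] by auto
    then have "\<rho> n \<le> 1 - k / n" "e n \<le> \<epsilon> * (k / n)" by (auto simp: field_simps)
    then have "\<rho> n * y n + e n \<le> (1 - k / n) * y n + \<epsilon> * (k / n)"
      using nonneg[of n] by (intro add_mono mult_right_mono) auto
    then have "y (Suc n) - \<epsilon> \<le> (1 - k / n) * (y n - \<epsilon>)"
      using n0[OF n] by (simp add: algebra_simps diff_divide_distrib)
    also have "\<dots> \<le> (1 - k / n) * z n"
      using n1 by (intro mult_left_mono) (auto simp: z_def field_simps)
    finally have "y (Suc n) - \<epsilon> \<le> (1 - k / n) * z n" .
    moreover have "0 \<le> (1 - k / n) * z n" using n1 z0 by (intro mult_nonneg_nonneg) auto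
    ultimately show ?thesis by (simp add: z_def)
  qed
  \<comment> \<open>The quotient of consecutive powers is at most exp (k/n), which is compensated by
    1 - k/n being at most exp (-k/n).\<close>
  have mono: "real (Suc n) powr k * z (Suc n) \<le> real n powr k * z n" if n: "n \<ge> n0" for n
  proof -
    have n1: "real n > 0" "real n > k" using n0[OF n] by auto
    have "ln (real (Suc n)) - ln (real n) \<le> 1 / n"
      using n1 ln_add_one_self_le_self[of "1 / real n"]
      by (simp add: ln_div[symmetric] add_divide_distrib add.commute flip: ln_divide_pos)
    from mult_left_mono[OF this, of k]
    have "k * ln (real (Suc n)) \<le> k * ln (real n) + k / n"
      using k by (simp add: right_diff_distrib)
    then have "real (Suc n) powr k \<le> real n powr k * exp (k / n)"
      using n1 by (simp add: powr_def flip: exp_add)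
    then have "real (Suc n) powr k * z (Suc n) \<le> (real n powr k * exp (k / n)) * ((1 - k / n) * z n)"
      using zs[OF n] z0 by (intro mult_mono) auto
    also have "\<dots> \<le> (real n powr k * exp (k / n)) * (exp (- (k / n)) * z n)"
      using z0[of n] exp_ge_add_one_self[of "- (k / n)"] by (intro mult_left_mono mult_right_mono) auto
    also have "\<dots> = real n powr k * z n" by (simp add: exp_minus)
    finally show ?thesis .
  qed
  have bound: "real n powr k * z n \<le> real n0 powr k * z n0" if "n \<ge> n0" for n
    using that by (induction n rule: dec_induct) (simp_all only: order_refl, metis mono order_trans)
  have "(\<lambda>n. real n0 powr k * z n0 * real n powr (- k)) \<longlonglongrightarrow> real n0 powr k * z n0 * 0"
    by (intro tendsto_mult_left tendsto_neg_powr filterlim_real_sequentially) (use k in auto)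
  then have "\<forall>\<^sub>F n in sequentially. real n0 powr k * z n0 * real n powr (- k) < \<epsilon>"
    by (intro order_tendstoD(2)[of _ 0]) (use \<epsilon> in auto)
  then have "\<forall>\<^sub>F n in sequentially. norm (y n - 0) < r"
    using eventually_ge_at_top[of n0] eventually_gt_at_top[of 0]
  proof eventually_elim
    case (elim n)
    then have "z n \<le> real n0 powr k * z n0 * real n powr (- k)"
      using bound[of n] by (simp add: powr_minus field_simps)
    then show ?case
      using elim nonneg[of n] by (simp add: z_def \<epsilon>_def)
  qed
  then show "\<exists>no. \<forall>n\<ge>no. norm (y n - 0) < r" by (simp add: eventually_sequentially)
qed

section \<open>Exponential estimates and the characteristic function of a two-point law\<close>

lemma abs_exp_neg_diff_le:
  fixes x y :: real
  assumes "0 \<le> x" "0 \<le> y"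
  shows "\<bar>exp (- x) - exp (- y)\<bar> \<le> \<bar>x - y\<bar>"
proof -
  have *: "exp (- x) - exp (- y) \<le> y - x" if "0 \<le> x" "x \<le> y" for x y :: real
  proof -
    have "exp (- x) - exp (- y) = exp (- x) * (1 - exp (- (y - x)))"
      by (simp add: algebra_simps flip: exp_add)
    also have "1 - exp (- (y - x)) \<le> y - x"
      using exp_ge_add_one_self[of "- (y - x)"] by linarith
    then have "exp (- x) * (1 - exp (- (y - x))) \<le> 1 * (y - x)"
      using that by (intro mult_mono) auto
    finally show ?thesis by simp
  qed
  then show ?thesis using assms *[of x y] *[of y x] by (cases "x \<le> y") auto
qed

lemma one_minus_exp_neg_approx:
  fixes x :: real assumes "0 \<le> x"
  shows "\<bar>exp (- x) - (1 - x)\<bar> \<le> x\<^sup>2"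
proof (cases "x \<le> 1")
  case True
  have "exp (- x) \<le> 1 / (1 + x)"
    using assms exp_ge_add_one_self[of x] by (simp add: exp_minus field_simps)
  \<comment> \<open>This is the factorisation (1 + x) (1 - x + x^2) = 1 + x^3.\<close>
  also have "\<dots> \<le> 1 - x + x\<^sup>2"
    using assms by (simp add: field_simps power2_eq_square power3_eq_cube)
  finally show ?thesis using exp_ge_add_one_self[of "- x"] by simp
next
  case False
  have "exp (- x) \<le> 1" "exp (-x) > 0" using assms by auto
  then have "\<bar>exp (- x) - (1 - x)\<bar> \<le> x" using False by (intro abs_leI) linarith+
  also have "x \<le> x\<^sup>2" using False by (simp add: power2_eq_square)
  finally show ?thesis .
qed

text \<open>For a Bernoulli variable e of parameter \<open>p + x\<close>, the first two terms form
  the characteristic function of e - p at \<open>s\<close>. It is compared with a drift factor for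
  the mean \<open>x\<close> times a Gaussian factor for the variance at \<open>x = 0\<close>. The
  bound is linear in the modulus of \<open>x\<close>, so that later only a first absolute moment has
  to be controlled.\<close>

lemma two_point_char_approx:
  fixes p x s :: real
  assumes p: "0 \<le> p" "p \<le> 1" and x: "\<bar>x\<bar> \<le> 1" "0 \<le> p + x" "p + x \<le> 1" and s: "\<bar>s\<bar> \<le> 1"
  shows "cmod (iexp (- (s * p)) + of_real (p + x) * (iexp (s * (1 - p)) - iexp (- (s * p)))
      - iexp (s * x) * exp (- (s\<^sup>2 * (p * (1 - p)) / 2))) \<le> s\<^sup>2 * \<bar>x\<bar> + \<bar>s\<bar> ^ 3"
proof -
  define R where "R y = iexp y - (1 + \<i> * y - y\<^sup>2 / 2)" for y :: real
  define v where "v = s\<^sup>2 * (p * (1 - p)) / 2"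
  have R: "cmod (R y) \<le> \<bar>y\<bar> ^ 3 / 6" for y
    using iexp_approx1[of y 2]
    by (simp add: R_def eval_nat_numeral algebra_simps power_mult_distrib)
  have pq: "0 \<le> p * (1 - p)" "p * (1 - p) \<le> 1 / 4"
    using p zero_le_power2[of "p - 1 / 2"] by (simp, simp add: power2_eq_square algebra_simps)
  have v: "0 \<le> v" "v \<le> s\<^sup>2 / 8"
    using mult_nonneg_nonneg[OF zero_le_power2[of s] pq(1)] mult_left_mono[OF pq(2) zero_le_power2[of s]]
    unfolding v_def by linarith+
  have s3: "s\<^sup>2 * s\<^sup>2 \<le> \<bar>s\<bar> ^ 3"
    using s mult_left_mono[of "\<bar>s\<bar>" 1 "\<bar>s\<bar> ^ 3"] 
    by (auto simp: power3_eq_cube power2_eq_square abs_mult algebra_simps abs_if split: if_splits)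
  \<comment> \<open>The second moment of e - p is \<open>p * (1 - p) + x * (1 - 2 * p)\<close>; its
    second summand gives the third term. The last three terms expand the product of
    \<open>iexp (s * x)\<close> and \<open>exp (- v)\<close> around 1.\<close>
  have eq: "iexp (- (s * p)) + of_real (p + x) * (iexp (s * (1 - p)) - iexp (- (s * p)))
      - iexp (s * x) * exp (- v)
    = of_real (1 - (p + x)) * R (- (s * p)) + of_real (p + x) * R (s * (1 - p))
      - of_real (s\<^sup>2 / 2 * (x * (1 - 2 * p))) - (iexp (s * x) - (1 + \<i> * (s * x)))
      - of_real (exp (- v) - (1 - v)) - (iexp (s * x) - 1) * of_real (exp (- v) - 1)"
    by (simp add: R_def v_def field_simps power2_eq_square)
  have a1: "cmod (of_real (1 - (p + x)) * R (- (s * p))) \<le> (1 - (p + x)) * (\<bar>s\<bar> ^ 3 / 6)"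
  proof -
    have "\<bar>- (s * p)\<bar> \<le> \<bar>s\<bar>" using p by (simp add: abs_mult mult_left_le)
    then have "\<bar>- (s * p)\<bar> ^ 3 \<le> \<bar>s\<bar> ^ 3" by (intro power_mono) auto
    then have "cmod (R (- (s * p))) \<le> \<bar>s\<bar> ^ 3 / 6" using R[of "- (s * p)"] by linarith
    then show ?thesis using x unfolding norm_mult norm_of_real by (intro mult_mono) auto
  qed
  have a2: "cmod (of_real (p + x) * R (s * (1 - p))) \<le> (p + x) * (\<bar>s\<bar> ^ 3 / 6)"
  proof -
    have "\<bar>s * (1 - p)\<bar> \<le> \<bar>s\<bar>" using p by (simp add: abs_mult mult_left_le)
    then have "\<bar>s * (1 - p)\<bar> ^ 3 \<le> \<bar>s\<bar> ^ 3" by (intro power_mono) auto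
    then have "cmod (R (s * (1 - p))) \<le> \<bar>s\<bar> ^ 3 / 6" using R[of "s * (1 - p)"] by linarith
    then show ?thesis using x unfolding norm_mult norm_of_real by (intro mult_mono) auto
  qed
  have a3: "cmod (of_real (s\<^sup>2 / 2 * (x * (1 - 2 * p)))) \<le> s\<^sup>2 / 2 * \<bar>x\<bar>"
    unfolding norm_of_real abs_mult using p by (intro mult_mono mult_left_le) auto
  \<comment> \<open>The Taylor remainder is quadratic in \<open>x\<close>; one factor is dropped
    using \<open>\<bar>x\<bar> \<le> 1\<close>.\<close>
  have a4: "cmod (iexp (s * x) - (1 + \<i> * (s * x))) \<le> s\<^sup>2 / 2 * \<bar>x\<bar>"
  proof -
    have "cmod (iexp (s * x) - (1 + \<i> * (s * x))) \<le> s\<^sup>2 * (\<bar>x\<bar> * \<bar>x\<bar>) / 2"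
      using iexp_approx1[of "s * x" 1] by (simp add: power2_eq_square abs_mult algebra_simps)
    also have "\<dots> \<le> s\<^sup>2 * (\<bar>x\<bar> * 1) / 2" using x by (intro divide_right_mono mult_left_mono) auto
    finally show ?thesis by simp
  qed
  have a5: "cmod (of_real (exp (- v) - (1 - v))) \<le> \<bar>s\<bar> ^ 3 / 64"
  proof -
    have "\<bar>exp (- v) - (1 - v)\<bar> \<le> v\<^sup>2" by (rule one_minus_exp_neg_approx[OF v(1)])
    also have "\<dots> \<le> (s\<^sup>2 / 8)\<^sup>2" using v by (intro power_mono) auto
    also have "\<dots> \<le> \<bar>s\<bar> ^ 3 / 64" using s3 by (simp add: power2_eq_square)
    finally show ?thesis by (simp only: norm_of_real)
  qed
  have a6: "cmod ((iexp (s * x) - 1) * of_real (exp (- v) - 1)) \<le> \<bar>s\<bar> ^ 3 / 8"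
  proof -
    have "cmod (iexp (s * x) - 1) \<le> \<bar>s * x\<bar>" using iexp_approx1[of "s * x" 0] by simp
    also have "\<dots> \<le> \<bar>s\<bar>" using x by (simp add: abs_mult mult_left_le)
    finally have 1: "cmod (iexp (s * x) - 1) \<le> \<bar>s\<bar>" .
    have "\<bar>exp (- v) - 1\<bar> \<le> s\<^sup>2 / 8" using abs_exp_neg_diff_le[of v 0] v by simp
    then have "cmod (iexp (s * x) - 1) * \<bar>exp (- v) - 1\<bar> \<le> \<bar>s\<bar> * (s\<^sup>2 / 8)"
      using 1 by (intro mult_mono) auto
    also have "\<dots> = \<bar>s\<bar> ^ 3 / 8" by (simp add: power2_eq_square power3_eq_cube)
    finally show ?thesis by (simp only: norm_mult norm_of_real)
  qed
  have "cmod (iexp (- (s * p)) + of_real (p + x) * (iexp (s * (1 - p)) - iexp (- (s * p)))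
      - iexp (s * x) * exp (- v)) \<le>
     (1 - (p + x)) * (\<bar>s\<bar> ^ 3 / 6) + (p + x) * (\<bar>s\<bar> ^ 3 / 6) + s\<^sup>2 / 2 * \<bar>x\<bar> + s\<^sup>2 / 2 * \<bar>x\<bar> + \<bar>s\<bar> ^ 3 / 64 + \<bar>s\<bar> ^ 3 / 8"
    unfolding eq
    by (intro order_trans[OF norm_triangle_ineq4] order_trans[OF norm_triangle_ineq] add_mono a1 a2 a3 a4 a5 a6)
  also have "\<dots> = s\<^sup>2 * \<bar>x\<bar> + (1/6 + 1/64 + 1/8) * \<bar>s\<bar> ^ 3" by (simp add: field_simps)
  also have "\<dots> \<le> s\<^sup>2 * \<bar>x\<bar> + \<bar>s\<bar> ^ 3" by simp
  finally show ?thesis by (simp add: v_def)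
qed

text \<open>This is nonnegativity of the variance of the absolute value of \<open>X\<close>.\<close>

lemma (in prob_space) expectation_abs_le_sqrt:
  assumes [measurable]: "X \<in> borel_measurable M" and X2: "integrable M (\<lambda>x. (X x)\<^sup>2 :: real)"
  shows "expectation (\<lambda>x. \<bar>X x\<bar>) \<le> sqrt (expectation (\<lambda>x. (X x)\<^sup>2))"
proof -
  have "integrable M (\<lambda>x. \<bar>X x\<bar>)"
    using square_integrable_imp_integrable[OF _ X2] by auto
  then have "variance (\<lambda>x. \<bar>X x\<bar>) = expectation (\<lambda>x. (X x)\<^sup>2) - (expectation (\<lambda>x. \<bar>X x\<bar>))\<^sup>2"
    using X2 by (subst variance_eq) auto
  then show ?thesis using variance_positive[of "\<lambda>x. \<bar>X x\<bar>"] by (intro real_le_rsqrt) linarith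
qed

section \<open>The centred urn process: dynamics and a priori bounds\<close>

context balanced_polya_urn
begin

definition p :: real where "p = real c / real (b + c)"

text \<open>The eigenvalues of the replacement matrix are \<open>S\<close> and
  \<open>m\<close>.\<close>

definition m :: real where "m = real a - real c"

definition urn_size :: "nat \<Rightarrow> real" where "urn_size n = real (\<alpha> + \<beta> + n * S)"

text \<open>On the urn this is the linear form (b x - c y) / (b + c) of the composition (x, y), an
  eigenform of the transposed replacement matrix for the eigenvalue \<open>m\<close>.\<close>

definition W :: "nat \<Rightarrow> 'a \<Rightarrow> real" where "W n \<omega> = U n \<omega> $ 1 - p * urn_size n"

definition chf :: "nat \<Rightarrow> real \<Rightarrow> complex" where "chf n \<theta> = (\<integral>\<omega>. iexp (\<theta> * W n \<omega>) \<partial>M)"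

lemma p_bounds: "0 \<le> p" "p \<le> 1"
  using not_diagonal by (auto simp: p_def divide_simps)

text \<open>Since c + m p = p a + (1 - p) c, this says that drawing red with probability
  \<open>p\<close> keeps the proportion \<open>p\<close> on average. It removes the deterministic
  drift in \<open>W_Suc\<close>.\<close>

lemma p_S: "p * real S = real c + m * p"
proof -
  have "p * (real b + real c) = real c" using not_diagonal by (simp add: p_def)
  moreover have "real S = real b + real c + m" by (simp add: m_def flip: balanced(1))
  ultimately show ?thesis by (simp add: algebra_simps)
qed

lemma urn_size_ge_1: "1 \<le> urn_size n"
  using initial_nonempty unfolding urn_size_def by (simp only: real_of_nat_ge_one_iff)

lemma urn_size_Suc: "urn_size (Suc n) = urn_size n + real S"
  by (simp add: urn_size_def)

lemma U_Suc_1: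
  "\<omega> \<in> space M \<Longrightarrow> U (Suc n) \<omega> $ 1 = U n \<omega> $ 1 + (if red (Suc n) \<omega> then real a else real c)"
  by (simp add: U_Suc replacement_matrix_def matrix_vector_mult_def transpose_def sum_2)

lemma U_Suc_2:
  "\<omega> \<in> space M \<Longrightarrow> U (Suc n) \<omega> $ 2 = U n \<omega> $ 2 + (if red (Suc n) \<omega> then real b else real d)"
  by (simp add: U_Suc replacement_matrix_def matrix_vector_mult_def transpose_def sum_2)

lemma U_nonneg: "\<omega> \<in> space M \<Longrightarrow> 0 \<le> U n \<omega> $ 1 \<and> 0 \<le> U n \<omega> $ 2"
  by (induction n) (auto simp: U_0 U_Suc_1 U_Suc_2)

lemma U_sum: "\<omega> \<in> space M \<Longrightarrow> U n \<omega> $ 1 + U n \<omega> $ 2 = urn_size n"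
proof (induction n)
  case 0
  then show ?case by (simp add: U_0 urn_size_def)
next
  case (Suc n)
  have "real a + real b = real S" "real c + real d = real S"
    by (simp_all flip: balanced(1), simp add: balanced flip: of_nat_add)
  then show ?case using Suc by (auto simp: U_Suc_1 U_Suc_2 urn_size_Suc)
qed

lemma U_1_eq: "U n \<omega> $ 1 = W n \<omega> + p * urn_size n"
  by (simp add: W_def)

lemma W_Suc: "\<omega> \<in> space M \<Longrightarrow> W (Suc n) \<omega> = W n \<omega> + m * (of_bool (red (Suc n) \<omega>) - p)"
  using p_S by (auto simp: W_def U_Suc_1 urn_size_Suc algebra_simps m_def)

text \<open>The proportion of red balls lies between 0 and 1, as does \<open>p\<close>. The
  resulting crude bound on \<open>W n\<close> settles the integrability questions below.\<close>

lemma red_fraction: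
  assumes "\<omega> \<in> space M"
  shows "U n \<omega> $ 1 / urn_size n = p + W n \<omega> / urn_size n"
    and "0 \<le> p + W n \<omega> / urn_size n" and "p + W n \<omega> / urn_size n \<le> 1"
    and "\<bar>W n \<omega>\<bar> \<le> urn_size n"
proof -
  have t: "urn_size n > 0" using urn_size_ge_1[of n] by simp
  show *: "U n \<omega> $ 1 / urn_size n = p + W n \<omega> / urn_size n"
    using t by (simp add: W_def field_simps)
  show "0 \<le> p + W n \<omega> / urn_size n" "p + W n \<omega> / urn_size n \<le> 1"
    unfolding *[symmetric] using U_nonneg[OF assms, of n] U_sum[OF assms, of n] t
    by (auto simp: divide_simps)
  then have "\<bar>W n \<omega> / urn_size n\<bar> \<le> 1" using p_bounds by linarith
  then show "\<bar>W n \<omega>\<bar> \<le> urn_size n" using t by (simp add: divide_simps)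
qed

section \<open>Measurability and conditioning on the past\<close>

text \<open>Adaptedness propagates from the draws: \<open>W 0\<close> is constant on the space and
  each step adds a function of one draw.\<close>

lemma W_F_measurable: "W n \<in> borel_measurable (F n)"
proof (induction n)
  case 0
  have "W 0 \<in> borel_measurable (F 0) \<longleftrightarrow> (\<lambda>\<omega>. real \<alpha> - p * urn_size 0) \<in> borel_measurable (F 0)"
    by (rule measurable_cong) (simp add: space_F W_def U_0)
  then show ?case by simp
next
  case (Suc n)
  have "subalgebra (F (Suc n)) (F n)"
    using sets_F_mono[of n "Suc n"] by (simp add: subalgebra_def space_F)
  from measurable_from_subalg[OF this Suc]
  have [measurable]: "W n \<in> borel_measurable (F (Suc n))" .
  note red_adapted[of n, measurable]
  have "W (Suc n) \<in> borel_measurable (F (Suc n)) \<longleftrightarrow>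
      (\<lambda>\<omega>. W n \<omega> + m * ((if red (Suc n) \<omega> then 1 else 0) - p)) \<in> borel_measurable (F (Suc n))"
    by (rule measurable_cong) (simp add: space_F W_Suc)
  also have "\<dots>" by measurable
  finally show ?case .
qed

lemma W_measurable [measurable]: "W n \<in> borel_measurable M"
  by (rule measurable_from_subalg[OF subalgebra_F W_F_measurable])

lemma red_measurable [measurable]: "Measurable.pred M (red (Suc n))"
  by (rule measurable_from_subalg[OF subalgebra_F red_adapted])

lemma of_bool_red_measurable [measurable]:
  "(\<lambda>\<omega>. of_bool (red (Suc n) \<omega>) :: real) \<in> borel_measurable M"
  unfolding of_bool_def by measurable

lemma integrable_bounded:
  fixes Z :: "'a \<Rightarrow> 'b :: {banach, second_countable_topology}"
  assumes "Z \<in> borel_measurable M" "\<And>\<omega>. \<omega> \<in> space M \<Longrightarrow> norm (Z \<omega>) \<le> B"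
  shows "integrable M Z"
  using assms by (intro integrable_const_bound[of _ B] AE_I2) auto

text \<open>This is \<open>draw_uniform\<close> tested against bounded functions of the past; the
  law of the draws enters the proof only through this identity.\<close>

lemma expectation_draw:
  fixes Z :: "'a \<Rightarrow> real"
  assumes Z: "Z \<in> borel_measurable (F n)" and B: "\<And>\<omega>. \<omega> \<in> space M \<Longrightarrow> \<bar>Z \<omega>\<bar> \<le> B"
  shows "expectation (\<lambda>\<omega>. Z \<omega> * of_bool (red (Suc n) \<omega>))
    = expectation (\<lambda>\<omega>. Z \<omega> * (p + W n \<omega> / urn_size n))"
proof -
  interpret sub: finite_measure_subalgebra M "F n"
    by unfold_locales (rule subalgebra_F)
  have [measurable]: "Z \<in> borel_measurable M" by (rule measurable_from_subalg[OF subalgebra_F Z])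
  have "integrable M (\<lambda>\<omega>. Z \<omega> * of_bool (red (Suc n) \<omega>))"
    using B by (intro integrable_bounded[of _ B]) (auto simp: of_bool_def intro: order_trans[OF abs_ge_zero])
  from sub.real_cond_exp_intg(2)[OF this Z]
  have "expectation (\<lambda>\<omega>. Z \<omega> * of_bool (red (Suc n) \<omega>))
     = expectation (\<lambda>\<omega>. Z \<omega> * real_cond_exp M (F n) (\<lambda>\<omega>. of_bool (red (Suc n) \<omega>)) \<omega>)" by simp
  also have "\<dots> = expectation (\<lambda>\<omega>. Z \<omega> * (U n \<omega> $ 1 / urn_size n))"
  proof (rule integral_cong_AE)
    show "(\<lambda>\<omega>. Z \<omega> * real_cond_exp M (F n) (\<lambda>\<omega>. of_bool (red (Suc n) \<omega>)) \<omega>) \<in> borel_measurable M"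
      by measurable
    show "(\<lambda>\<omega>. Z \<omega> * (U n \<omega> $ 1 / urn_size n)) \<in> borel_measurable M"
      unfolding U_1_eq by measurable
    show "AE \<omega> in M. Z \<omega> * real_cond_exp M (F n) (\<lambda>\<omega>. of_bool (red (Suc n) \<omega>)) \<omega>
        = Z \<omega> * (U n \<omega> $ 1 / urn_size n)"
      using draw_uniform[of n] by eventually_elim (simp add: urn_size_def)
  qed
  also have "\<dots> = expectation (\<lambda>\<omega>. Z \<omega> * (p + W n \<omega> / urn_size n))"
    by (intro Bochner_Integration.integral_cong) (auto simp: red_fraction(1))
  finally show ?thesis .
qed

text \<open>The function \<open>real_cond_exp\<close> is real-valued, so real and imaginary parts
  are treated separately.\<close>

lemma expectation_draw_complex:
  fixes Z :: "'a \<Rightarrow> complex"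
  assumes Z: "Z \<in> borel_measurable (F n)" and B: "\<And>\<omega>. \<omega> \<in> space M \<Longrightarrow> cmod (Z \<omega>) \<le> B"
  shows "(\<integral>\<omega>. Z \<omega> * of_real (of_bool (red (Suc n) \<omega>)) \<partial>M) = (\<integral>\<omega>. Z \<omega> * of_real (p + W n \<omega> / urn_size n) \<partial>M)"
proof -
  have [measurable]: "Z \<in> borel_measurable M" by (rule measurable_from_subalg[OF subalgebra_F Z])
  have 1: "integrable M (\<lambda>\<omega>. Z \<omega> * of_real (of_bool (red (Suc n) \<omega>)))"
    using B by (intro integrable_bounded[of _ B]) (auto simp: of_bool_def intro: order_trans[OF norm_ge_zero])
  have 2: "integrable M (\<lambda>\<omega>. Z \<omega> * of_real (p + W n \<omega> / urn_size n))"
  proof (rule integrable_bounded)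
    fix \<omega> assume \<omega>: "\<omega> \<in> space M"
    have "cmod (Z \<omega> * of_real (p + W n \<omega> / urn_size n)) = cmod (Z \<omega>) * (p + W n \<omega> / urn_size n)"
      using red_fraction(2)[OF \<omega>, of n] by (simp only: norm_mult norm_of_real abs_of_nonneg)
    also have "\<dots> \<le> B * 1"
      using red_fraction[OF \<omega>, of n] B[OF \<omega>] by (intro mult_mono) (auto intro: order_trans[OF norm_ge_zero])
    finally show "cmod (Z \<omega> * of_real (p + W n \<omega> / urn_size n)) \<le> B * 1" .
  qed measurable
  have B': "\<bar>Re (Z \<omega>)\<bar> \<le> B" "\<bar>Im (Z \<omega>)\<bar> \<le> B" if "\<omega> \<in> space M" for \<omega>
    using B[OF that] abs_Re_le_cmod[of "Z \<omega>"] abs_Im_le_cmod[of "Z \<omega>"] by auto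
  have [measurable]: "(\<lambda>\<omega>. Re (Z \<omega>)) \<in> borel_measurable (F n)" "(\<lambda>\<omega>. Im (Z \<omega>)) \<in> borel_measurable (F n)"
    using Z by measurable
  show ?thesis
  proof (rule complex_eqI)
    show "Re (\<integral>\<omega>. Z \<omega> * of_real (of_bool (red (Suc n) \<omega>)) \<partial>M)
      = Re (\<integral>\<omega>. Z \<omega> * of_real (p + W n \<omega> / urn_size n) \<partial>M)"
      unfolding integral_Re[OF 1, symmetric] integral_Re[OF 2, symmetric]
      using expectation_draw[of "\<lambda>\<omega>. Re (Z \<omega>)" n B] B' by simp
    show "Im (\<integral>\<omega>. Z \<omega> * of_real (of_bool (red (Suc n) \<omega>)) \<partial>M)
      = Im (\<integral>\<omega>. Z \<omega> * of_real (p + W n \<omega> / urn_size n) \<partial>M)"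
      unfolding integral_Im[OF 1, symmetric] integral_Im[OF 2, symmetric]
      using expectation_draw[of "\<lambda>\<omega>. Im (Z \<omega>)" n B] B' by simp
  qed
qed

section \<open>One-step recursion for the characteristic functions\<close>

text \<open>Any function of a 0-1 variable is affine in it. Hence the exponential of the increment
  is affine in the draw, and the draw may be replaced by its conditional probability.\<close>

lemma chf_Suc:
  "chf (Suc n) \<theta> = (\<integral>\<omega>. iexp (\<theta> * W n \<omega>) * (iexp (- (\<theta> * m * p))
     + of_real (p + W n \<omega> / urn_size n) * (iexp (\<theta> * m * (1 - p)) - iexp (- (\<theta> * m * p)))) \<partial>M)"
proof -
  define u where "u = iexp (- (\<theta> * m * p))"
  define v where "v = iexp (\<theta> * m * (1 - p)) - iexp (- (\<theta> * m * p))"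
  define Z where "Z = (\<lambda>\<omega>. iexp (\<theta> * W n \<omega>))"
  have Z: "Z \<in> borel_measurable (F n)" unfolding Z_def using W_F_measurable[of n] by measurable
  have [measurable]: "Z \<in> borel_measurable M" by (rule measurable_from_subalg[OF subalgebra_F Z])
  have nZ: "cmod (Z \<omega>) = 1" for \<omega> by (simp add: Z_def del: of_real_mult)
  have I: "integrable M Z" by (rule integrable_bounded[of _ 1]) (auto simp: nZ)
  have I1: "integrable M (\<lambda>\<omega>. Z \<omega> * of_real (of_bool (red (Suc n) \<omega>)))"
    by (rule integrable_bounded[of _ 1]) (auto simp: nZ norm_mult)
  have I2: "integrable M (\<lambda>\<omega>. Z \<omega> * of_real (p + W n \<omega> / urn_size n))"
  proof (rule integrable_bounded)
    fix \<omega> assume \<omega>: "\<omega> \<in> space M"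
    show "cmod (Z \<omega> * of_real (p + W n \<omega> / urn_size n)) \<le> 1"
      using red_fraction[OF \<omega>, of n] by (simp add: norm_mult nZ del: of_real_add)
  qed measurable
  have "chf (Suc n) \<theta> = (\<integral>\<omega>. Z \<omega> * u + Z \<omega> * of_real (of_bool (red (Suc n) \<omega>)) * v \<partial>M)"
    unfolding chf_def
  proof (intro Bochner_Integration.integral_cong refl)
    fix \<omega> assume "\<omega> \<in> space M"
    then show "iexp (\<theta> * W (Suc n) \<omega>) = Z \<omega> * u + Z \<omega> * of_real (of_bool (red (Suc n) \<omega>)) * v"
      by (auto simp: W_Suc Z_def u_def v_def ring_distribs mult_ac simp flip: exp_add)
  qed
  also have "\<dots> = (\<integral>\<omega>. Z \<omega> \<partial>M) * u + (\<integral>\<omega>. Z \<omega> * of_real (of_bool (red (Suc n) \<omega>)) \<partial>M) * v"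
    using I I1 by (subst Bochner_Integration.integral_add) auto
  also have "(\<integral>\<omega>. Z \<omega> * of_real (of_bool (red (Suc n) \<omega>)) \<partial>M) = (\<integral>\<omega>. Z \<omega> * of_real (p + W n \<omega> / urn_size n) \<partial>M)"
    using nZ by (intro expectation_draw_complex[OF Z, of 1]) simp
  also have "(\<integral>\<omega>. Z \<omega> \<partial>M) * u + \<dots> * v = (\<integral>\<omega>. Z \<omega> * u + Z \<omega> * of_real (p + W n \<omega> / urn_size n) * v \<partial>M)"
    using I I2 by (subst Bochner_Integration.integral_add) auto
  finally show ?thesis unfolding Z_def u_def v_def by (simp only: distrib_left mult.assoc)
qed

lemma W_integrable:
  "integrable M (W n)" "integrable M (\<lambda>\<omega>. \<bar>W n \<omega>\<bar>)" "integrable M (\<lambda>\<omega>. (W n \<omega>)\<^sup>2)"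
proof -
  show "integrable M (W n)" by (rule integrable_bounded[of _ "urn_size n"]) (auto simp: red_fraction)
  then show "integrable M (\<lambda>\<omega>. \<bar>W n \<omega>\<bar>)" by simp
  show "integrable M (\<lambda>\<omega>. (W n \<omega>)\<^sup>2)"
  proof (rule integrable_bounded)
    fix \<omega> assume "\<omega> \<in> space M"
    from red_fraction(4)[OF this, of n] show "norm ((W n \<omega>)\<^sup>2) \<le> (urn_size n)\<^sup>2"
      using urn_size_ge_1[of n] by (simp add: abs_le_square_iff[symmetric])
  qed measurable
qed

text \<open>The estimate of \<open>two_point_char_approx\<close> is integrated with x = W / tau. The
  drift factor then merges with \<open>iexp (\<theta> * W n \<omega>)\<close> and rescales the
  argument by 1 + m / tau.\<close>

lemma chf_step:
  assumes "\<bar>\<theta> * m\<bar> \<le> 1"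
  shows "cmod (chf (Suc n) \<theta> - chf n (\<theta> * (1 + m / urn_size n)) * exp (- ((\<theta> * m)\<^sup>2 * (p * (1 - p)) / 2)))
    \<le> (\<theta> * m)\<^sup>2 * (expectation (\<lambda>\<omega>. \<bar>W n \<omega>\<bar>) / urn_size n) + \<bar>\<theta> * m\<bar> ^ 3"
proof -
  define s where "s = \<theta> * m"
  define G where "G x = iexp (- (s * p)) + of_real (p + x) * (iexp (s * (1 - p)) - iexp (- (s * p)))" for x
  define H where "H x = iexp (s * x) * exp (- (s\<^sup>2 * (p * (1 - p)) / 2))" for x
  have t: "urn_size n > 0" using urn_size_ge_1[of n] by simp
  have est: "cmod (iexp (\<theta> * W n \<omega>) * (G (W n \<omega> / urn_size n) - H (W n \<omega> / urn_size n)))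
     \<le> s\<^sup>2 * (\<bar>W n \<omega>\<bar> / urn_size n) + \<bar>s\<bar> ^ 3" if "\<omega> \<in> space M" for \<omega>
    using two_point_char_approx[of p "W n \<omega> / urn_size n" s] red_fraction[OF that, of n] p_bounds assms t
    by (simp add: norm_mult G_def H_def s_def del: of_real_mult)
  have I: "integrable M (\<lambda>\<omega>. s\<^sup>2 * (\<bar>W n \<omega>\<bar> / urn_size n) + \<bar>s\<bar> ^ 3)"
    using W_integrable(2)[of n] by auto
  have [measurable]: "G \<in> borel_measurable borel" "H \<in> borel_measurable borel"
    unfolding G_def H_def by measurable
  have ID: "integrable M (\<lambda>\<omega>. iexp (\<theta> * W n \<omega>) * (G (W n \<omega> / urn_size n) - H (W n \<omega> / urn_size n)))"
  proof (rule Bochner_Integration.integrable_bound[OF I])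
    show "AE \<omega> in M. cmod (iexp (\<theta> * W n \<omega>) * (G (W n \<omega> / urn_size n) - H (W n \<omega> / urn_size n)))
        \<le> norm (s\<^sup>2 * (\<bar>W n \<omega>\<bar> / urn_size n) + \<bar>s\<bar> ^ 3)"
      unfolding real_norm_def by (intro AE_I2 order_trans[OF est abs_ge_self])
  qed measurable
  have IH: "integrable M (\<lambda>\<omega>. iexp (\<theta> * W n \<omega>) * H (W n \<omega> / urn_size n))"
    by (rule integrable_bounded[of _ "cmod (exp (- (s\<^sup>2 * (p * (1 - p)) / 2)))"])
       (auto simp: H_def norm_mult simp del: of_real_mult)
  have "chf (Suc n) \<theta> = (\<integral>\<omega>. iexp (\<theta> * W n \<omega>) * (G (W n \<omega> / urn_size n) - H (W n \<omega> / urn_size n))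
      + iexp (\<theta> * W n \<omega>) * H (W n \<omega> / urn_size n) \<partial>M)"
    unfolding chf_Suc by (intro Bochner_Integration.integral_cong refl) (simp add: G_def s_def algebra_simps)
  also have "\<dots> = (\<integral>\<omega>. iexp (\<theta> * W n \<omega>) * (G (W n \<omega> / urn_size n) - H (W n \<omega> / urn_size n)) \<partial>M)
      + (\<integral>\<omega>. iexp (\<theta> * W n \<omega>) * H (W n \<omega> / urn_size n) \<partial>M)"
    using ID IH by (rule Bochner_Integration.integral_add)
  also have "(\<integral>\<omega>. iexp (\<theta> * W n \<omega>) * H (W n \<omega> / urn_size n) \<partial>M)
      = chf n (\<theta> * (1 + m / urn_size n)) * exp (- ((\<theta> * m)\<^sup>2 * (p * (1 - p)) / 2))"
  proof -
    have "iexp (\<theta> * W n \<omega>) * H (W n \<omega> / urn_size n)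
      = iexp (\<theta> * (1 + m / urn_size n) * W n \<omega>) * exp (- ((\<theta> * m)\<^sup>2 * (p * (1 - p)) / 2))" for \<omega>
      by (simp add: H_def s_def algebra_simps exp_add)
    then show ?thesis by (simp add: chf_def)
  qed
  finally have "cmod (chf (Suc n) \<theta> - chf n (\<theta> * (1 + m / urn_size n)) * exp (- ((\<theta> * m)\<^sup>2 * (p * (1 - p)) / 2)))
    = cmod (\<integral>\<omega>. iexp (\<theta> * W n \<omega>) * (G (W n \<omega> / urn_size n) - H (W n \<omega> / urn_size n)) \<partial>M)" by simp
  also have "\<dots> \<le> (\<integral>\<omega>. cmod (iexp (\<theta> * W n \<omega>) * (G (W n \<omega> / urn_size n) - H (W n \<omega> / urn_size n))) \<partial>M)"
    by (rule integral_norm_bound)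
  also have "\<dots> \<le> (\<integral>\<omega>. s\<^sup>2 * (\<bar>W n \<omega>\<bar> / urn_size n) + \<bar>s\<bar> ^ 3 \<partial>M)"
    using ID I est by (intro integral_mono) auto
  also have "\<dots> = s\<^sup>2 * (expectation (\<lambda>\<omega>. \<bar>W n \<omega>\<bar>) / urn_size n) + \<bar>s\<bar> ^ 3"
    using W_integrable(2)[of n] by (subst Bochner_Integration.integral_add) (auto simp: prob_space)
  finally show ?thesis by (simp add: s_def)
qed

section \<open>Growth of the second moments\<close>

text \<open>In the expanded square the terms linear in \<open>W n\<close> cancel after conditioning,
  and the cross term leaves 2 m W^2 / tau. The squared increment is at most
  \<open>m\<^sup>2\<close>.\<close>

lemma second_moment_step:
  "expectation (\<lambda>\<omega>. (W (Suc n) \<omega>)\<^sup>2) \<le> (1 + 2 * m / urn_size n) * expectation (\<lambda>\<omega>. (W n \<omega>)\<^sup>2) + m\<^sup>2"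
proof -
  have IR: "integrable M (\<lambda>\<omega>. W n \<omega> * of_bool (red (Suc n) \<omega>))"
    by (rule integrable_bounded[of _ "urn_size n"])
       (use red_fraction(4)[of _ n] urn_size_ge_1[of n] in \<open>auto simp: of_bool_def\<close>)
  note I = W_integrable[of n] IR
  have "expectation (\<lambda>\<omega>. (W (Suc n) \<omega>)\<^sup>2)
      \<le> expectation (\<lambda>\<omega>. (W n \<omega>)\<^sup>2 + 2 * m * (W n \<omega> * of_bool (red (Suc n) \<omega>)) - 2 * m * p * W n \<omega> + m\<^sup>2)"
  proof (rule integral_mono[OF W_integrable(3)])
    fix \<omega> assume \<omega>: "\<omega> \<in> space M"
    have "(m * (of_bool (red (Suc n) \<omega>) - p))\<^sup>2 \<le> m\<^sup>2 * 1"
      using p_bounds unfolding power_mult_distrib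
      by (intro mult_left_mono) (auto simp: abs_square_le_1)
    moreover have "(W (Suc n) \<omega>)\<^sup>2 = (W n \<omega>)\<^sup>2 + 2 * m * (W n \<omega> * of_bool (red (Suc n) \<omega>))
        - 2 * m * p * W n \<omega> + (m * (of_bool (red (Suc n) \<omega>) - p))\<^sup>2"
      unfolding W_Suc[OF \<omega>] by algebra
    ultimately show "(W (Suc n) \<omega>)\<^sup>2
        \<le> (W n \<omega>)\<^sup>2 + 2 * m * (W n \<omega> * of_bool (red (Suc n) \<omega>)) - 2 * m * p * W n \<omega> + m\<^sup>2"
      by linarith
  qed (use I in auto)
  also have "\<dots> = expectation (\<lambda>\<omega>. (W n \<omega>)\<^sup>2) + 2 * m * expectation (\<lambda>\<omega>. W n \<omega> * of_bool (red (Suc n) \<omega>))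
      - 2 * m * p * expectation (W n) + m\<^sup>2"
    using I by (simp add: prob_space)
  also have "expectation (\<lambda>\<omega>. W n \<omega> * of_bool (red (Suc n) \<omega>)) = expectation (\<lambda>\<omega>. W n \<omega> * (p + W n \<omega> / urn_size n))"
    by (rule expectation_draw[OF W_F_measurable, of n "urn_size n"]) (rule red_fraction(4))
  also have "\<dots> = expectation (\<lambda>\<omega>. W n \<omega> * p + (W n \<omega>)\<^sup>2 / urn_size n)"
    by (simp add: algebra_simps power2_eq_square)
  also have "\<dots> = p * expectation (W n) + expectation (\<lambda>\<omega>. (W n \<omega>)\<^sup>2) / urn_size n"
    using I by simp
  finally show ?thesis by (simp add: algebra_simps)
qed

lemma urn_size_asymp:
  "(\<lambda>n. real n / urn_size n) \<longlonglongrightarrow> 1 / real S"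
proof -
  have "real S > 0" using S_ge_1 by simp
  then show ?thesis
    unfolding urn_size_def of_nat_add of_nat_mult by (real_asymp, simp add: divide_inverse)
qed

text \<open>The second moment divided by n^2 satisfies a contraction with rate 2 - 2
  \<open>\<sigma>\<close> and a source of order 1/n^2, so it tends to 0. Taking square roots bounds
  the first absolute moment.\<close>

lemma mean_abs_W_negligible:
  assumes small: "m / real S < 1 / 2"
  shows "(\<lambda>n. expectation (\<lambda>\<omega>. \<bar>W n \<omega>\<bar>) / urn_size n) \<longlonglongrightarrow> 0"
proof -
  define w where "w n = expectation (\<lambda>\<omega>. (W n \<omega>)\<^sup>2)" for n
  define \<rho> where "\<rho> n = (real n / (real n + 1))\<^sup>2 * (1 + 2 * m / urn_size n)" for n
  define e where "e n = m\<^sup>2 / (real n + 1)\<^sup>2" for n :: nat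
  have S: "real S > 0" using S_ge_1 by simp
  have w0: "0 \<le> w n" for n by (simp add: w_def)
  have "(\<lambda>n. w n / (real n)\<^sup>2) \<longlonglongrightarrow> 0"
  proof (rule contraction_tendsto_0[of _ \<rho> e])
    \<comment> \<open>At n = 0 the quotient is 0 by the convention for division, so the recursion is
      shown for positive n.\<close>
    show "\<forall>\<^sub>F n in sequentially. w (Suc n) / (real (Suc n))\<^sup>2 \<le> \<rho> n * (w n / (real n)\<^sup>2) + e n"
      using eventually_gt_at_top[of 0]
    proof eventually_elim
      case (elim n)
      have "w (Suc n) / (real (Suc n))\<^sup>2 \<le> ((1 + 2 * m / urn_size n) * w n + m\<^sup>2) / (real (Suc n))\<^sup>2"
        unfolding w_def by (intro divide_right_mono second_moment_step) auto
      also have "\<dots> = \<rho> n * (w n / (real n)\<^sup>2) + e n"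
        using elim by (simp add: \<rho>_def e_def power_divide add_divide_distrib add.commute)
      finally show ?case .
    qed
    \<comment> \<open>The change of normalisation contributes 2, the drift of the urn contributes
      minus twice \<open>m / real S\<close>.\<close>
    show "(\<lambda>n. real n * (1 - \<rho> n)) \<longlonglongrightarrow> 2 - 2 * (m / real S)"
      unfolding \<rho>_def urn_size_def of_nat_add of_nat_mult using S
      by (real_asymp, simp add: divide_inverse)
    show "(\<lambda>n. real n * e n) \<longlonglongrightarrow> 0" unfolding e_def by real_asymp
    show "2 - 2 * (m / real S) > 0" using small by linarith
  qed (use w0 in auto)
  from tendsto_mult[OF tendsto_real_sqrt[OF this] urn_size_asymp]
  have lim: "(\<lambda>n. sqrt (w n / (real n)\<^sup>2) * (real n / urn_size n)) \<longlonglongrightarrow> 0" by simp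
  show ?thesis
  proof (rule Lim_null_comparison[OF _ lim])
    show "\<forall>\<^sub>F n in sequentially. norm (expectation (\<lambda>\<omega>. \<bar>W n \<omega>\<bar>) / urn_size n)
        \<le> sqrt (w n / (real n)\<^sup>2) * (real n / urn_size n)"
      using eventually_gt_at_top[of 0]
    proof eventually_elim
      case (elim n)
      have "expectation (\<lambda>\<omega>. \<bar>W n \<omega>\<bar>) / urn_size n \<le> sqrt (w n) / urn_size n"
        unfolding w_def using urn_size_ge_1[of n]
        by (intro divide_right_mono expectation_abs_le_sqrt W_integrable) auto
      then show ?case using elim urn_size_ge_1[of n] by (simp add: real_sqrt_divide)
    qed
  qed
qed

section \<open>Convergence of the rescaled characteristic functions\<close>

text \<open>This crude bound starts the induction in \<open>chf_tendsto\<close>, where the initial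
  error must be proportional to the modulus of the argument.\<close>

lemma chf_near_1: "cmod (chf n \<theta> - 1) \<le> \<bar>\<theta>\<bar> * urn_size n"
proof -
  have I: "integrable M (\<lambda>\<omega>. iexp (\<theta> * W n \<omega>))"
    by (rule integrable_bounded[of _ 1]) (auto simp del: of_real_mult)
  then have "cmod (chf n \<theta> - 1) = cmod (\<integral>\<omega>. iexp (\<theta> * W n \<omega>) - 1 \<partial>M)"
    by (simp add: chf_def prob_space del: of_real_mult)
  also have "\<dots> \<le> (\<integral>\<omega>. cmod (iexp (\<theta> * W n \<omega>) - 1) \<partial>M)" by (rule integral_norm_bound)
  also have "\<dots> \<le> (\<integral>\<omega>. \<bar>\<theta>\<bar> * urn_size n \<partial>M)"
  proof (rule integral_mono)
    fix \<omega> assume "\<omega> \<in> space M"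
    have "cmod (iexp (\<theta> * W n \<omega>) - 1) \<le> \<bar>\<theta> * W n \<omega>\<bar>" using iexp_approx1[of "\<theta> * W n \<omega>" 0] by simp
    also have "\<dots> \<le> \<bar>\<theta>\<bar> * urn_size n"
      unfolding abs_mult using red_fraction(4)[OF \<open>\<omega> \<in> space M\<close>] by (intro mult_left_mono) auto
    finally show "cmod (iexp (\<theta> * W n \<omega>) - 1) \<le> \<bar>\<theta>\<bar> * urn_size n" .
  qed (use I in auto)
  finally show ?thesis by (simp add: prob_space)
qed

text \<open>This is the solution v of v (1 - 2 \<open>\<sigma>\<close>) = m^2 p (1 - p), where the
  loss of variance by rescaling balances the noise of a new draw. As p (1 - p) = b c / (b + c)^2, it
  is the scalar factor of the limiting covariance matrix.\<close>

definition asymp_var :: real where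
  "asymp_var = m\<^sup>2 * (p * (1 - p)) / (1 - 2 * (m / real S))"

text \<open>
  The error at time \<open>n\<close> is measured relative to \<open>\<bar>t\<bar>\<close>, because rescaling from \<open>sqrt n\<close> to
  \<open>sqrt (n + 1)\<close> shrinks the argument \<open>t\<close> by the factor \<open>\<rho> n \<approx> 1 - (1/2 - \<sigma>) / n\<close>:
  smallness of the urn makes the recursion a contraction.
\<close>

lemma chf_tendsto:
  assumes small: "m / real S < 1 / 2"
  shows "(\<lambda>n. chf n (t / sqrt (real n))) \<longlonglongrightarrow> exp (- (asymp_var * t\<^sup>2 / 2))"
proof -
  \<comment> \<open>The recursion evaluates the previous characteristic function at a smaller
    argument, so all estimates are made uniformly on the interval from -T to T.\<close>
  define T where "T = \<bar>t\<bar> + 1"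
  have T: "T > 0" "\<bar>t\<bar> \<le> T" by (auto simp: T_def)
  define v where "v = asymp_var"
  define k where "k = m\<^sup>2 * (p * (1 - p))"
  define g where "g x = exp (- (v * x\<^sup>2 / 2))" for x :: real
  define \<eta> where "\<eta> n = expectation (\<lambda>\<omega>. \<bar>W n \<omega>\<bar>) / urn_size n" for n
  define \<rho> where "\<rho> n = sqrt (real n / (real n + 1)) * (1 + m / urn_size n)" for n
  \<comment> \<open>The first two summands are the error of \<open>chf_step\<close>, the third is
    the amount by which the Gaussian \<open>g\<close> fails to be a fixed point.\<close>
  define e where "e n = T * m\<^sup>2 / (real n + 1) * \<eta> n + T\<^sup>2 * \<bar>m\<bar> ^ 3 / sqrt (real n + 1) ^ 3
    + T / 2 * \<bar>v * (1 - (\<rho> n)\<^sup>2) - k / (real n + 1)\<bar>" for n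
  have S: "real S > 0" using S_ge_1 by simp
  have k: "k \<ge> 0" using p_bounds by (simp add: k_def)
  have v: "v \<ge> 0" "v * (1 - 2 * (m / real S)) = k"
  proof -
    define q where "q = 1 - 2 * (m / real S)"
    have "q > 0" using small unfolding q_def by linarith
    moreover have "v = k / q" by (simp add: v_def asymp_var_def k_def q_def)
    ultimately show "v \<ge> 0" "v * (1 - 2 * (m / real S)) = k"
      using k unfolding q_def[symmetric] by simp_all
  qed
  have \<eta>0: "\<eta> n \<ge> 0" for n using urn_size_ge_1[of n] by (simp add: \<eta>_def)
  have e0: "e n \<ge> 0" for n unfolding e_def using T \<eta>0[of n] by simp
  have sqrt_lim: "(\<lambda>n. sqrt (real n / (real n + 1))) \<longlonglongrightarrow> 1"
    "(\<lambda>n. real n * (1 - sqrt (real n / (real n + 1)))) \<longlonglongrightarrow> 1 / 2"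
    by real_asymp+
  have \<rho>_lim: "(\<lambda>n. real n * (1 - \<rho> n)) \<longlonglongrightarrow> 1 / 2 - m / real S"
  proof -
    have "(\<lambda>n. real n * (1 - sqrt (real n / (real n + 1))) - sqrt (real n / (real n + 1)) * (m * (real n / urn_size n)))
        \<longlonglongrightarrow> 1 / 2 - 1 * (m * (1 / real S))"
      by (intro tendsto_intros sqrt_lim urn_size_asymp)
    then show ?thesis by (simp add: \<rho>_def algebra_simps)
  qed
  have \<rho>_1: "\<rho> \<longlonglongrightarrow> 1"
  proof -
    have "(\<lambda>n. 1 - 1 / real n * (real n * (1 - \<rho> n))) \<longlonglongrightarrow> 1 - 0 * (1 / 2 - m / real S)"
      by (intro tendsto_intros \<rho>_lim lim_1_over_n)
    then have "(\<lambda>n. 1 - 1 / real n * (real n * (1 - \<rho> n))) \<longlonglongrightarrow> 1" by simp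
    then show ?thesis
      by (rule Lim_transform_eventually)
        (use eventually_gt_at_top[of "0::nat"] in eventually_elim, simp)
  qed
  have \<rho>2_lim: "(\<lambda>n. real n * (1 - (\<rho> n)\<^sup>2)) \<longlonglongrightarrow> 1 - 2 * (m / real S)"
    using tendsto_mult[OF \<rho>_lim tendsto_add[OF tendsto_const[of 1] \<rho>_1]]
    by (simp add: power2_eq_square algebra_simps)
  have e_lim: "(\<lambda>n. real n * e n) \<longlonglongrightarrow> 0"
  proof -
    have n1: "(\<lambda>n. real n / (real n + 1)) \<longlonglongrightarrow> 1" by real_asymp
    have "(\<lambda>n. T * m\<^sup>2 * (real n / (real n + 1)) * \<eta> n) \<longlonglongrightarrow> T * m\<^sup>2 * 1 * 0"
      unfolding \<eta>_def by (intro tendsto_intros mean_abs_W_negligible[OF small] n1)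
    then have 1: "(\<lambda>n. real n * (T * m\<^sup>2 / (real n + 1)) * \<eta> n) \<longlonglongrightarrow> 0"
      by (simp add: mult_ac)
    have 2: "(\<lambda>n. real n * (T\<^sup>2 * \<bar>m\<bar> ^ 3 / sqrt (real n + 1) ^ 3)) \<longlonglongrightarrow> 0"
    proof -
      have "(\<lambda>n. real n / sqrt (real n + 1) ^ 3) \<longlonglongrightarrow> 0" by real_asymp
      from tendsto_mult_left[OF this, of "T\<^sup>2 * \<bar>m\<bar> ^ 3"] show ?thesis by (simp add: mult_ac)
    qed
    \<comment> \<open>The choice of \<open>v\<close> makes this limit vanish: it is the variance
      balance \<open>v * (1 - 2 * (m / real S)) = k\<close>.\<close>
    have "(\<lambda>n. T / 2 * \<bar>v * (real n * (1 - (\<rho> n)\<^sup>2)) - k * (real n / (real n + 1))\<bar>)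
        \<longlonglongrightarrow> T / 2 * \<bar>v * (1 - 2 * (m / real S)) - k * 1\<bar>"
      by (intro tendsto_intros \<rho>2_lim n1)
    then have 3: "(\<lambda>n. T / 2 * \<bar>v * (real n * (1 - (\<rho> n)\<^sup>2)) - real n * (k / (real n + 1))\<bar>)
        \<longlonglongrightarrow> 0"
      unfolding v(2) by (simp add: mult_ac)
    have "real n * e n = real n * (T * m\<^sup>2 / (real n + 1)) * \<eta> n
        + real n * (T\<^sup>2 * \<bar>m\<bar> ^ 3 / sqrt (real n + 1) ^ 3)
        + T / 2 * \<bar>v * (real n * (1 - (\<rho> n)\<^sup>2)) - real n * (k / (real n + 1))\<bar>" for n
    proof -
      have "v * (real n * (1 - (\<rho> n)\<^sup>2)) - real n * (k / (real n + 1))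
        = real n * (v * (1 - (\<rho> n)\<^sup>2) - k / (real n + 1))" by (simp add: algebra_simps)
      then show ?thesis by (simp add: e_def abs_mult distrib_left) (simp add: mult_ac)
    qed
    with tendsto_add[OF tendsto_add[OF 1 2] 3] show ?thesis by simp
  qed
  have recursion: "cmod (chf (Suc n) (t / sqrt (real (Suc n))) - g t) \<le> (\<rho> n * y + e n) * \<bar>t\<bar>"
    if n: "n > 0" "T * \<bar>m\<bar> / sqrt (real n + 1) \<le> 1" "0 \<le> \<rho> n" "\<rho> n \<le> 1" and t: "\<bar>t\<bar> \<le> T"
      and IH: "\<And>t. \<bar>t\<bar> \<le> T \<Longrightarrow> cmod (chf n (t / sqrt (real n)) - g t) \<le> y * \<bar>t\<bar>" for n t y
  proof -
    define \<theta> where "\<theta> = t / sqrt (real n + 1)"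
    define E where "E = exp (- ((\<theta> * m)\<^sup>2 * (p * (1 - p)) / 2))"
    have \<theta>m: "\<bar>\<theta> * m\<bar> \<le> 1"
    proof -
      have "\<bar>\<theta> * m\<bar> \<le> T * \<bar>m\<bar> / sqrt (real n + 1)"
        unfolding \<theta>_def using t by (simp add: abs_mult divide_right_mono mult_right_mono)
      then show ?thesis using n(2) by (rule order_trans)
    qed
    have \<theta>2: "(\<theta> * m)\<^sup>2 = t\<^sup>2 * (m\<^sup>2 / (real n + 1))"
      by (simp add: \<theta>_def power_mult_distrib power_divide)
    have \<theta>\<rho>: "\<theta> * (1 + m / urn_size n) = t * \<rho> n / sqrt (real n)"
      using n by (simp add: \<theta>_def \<rho>_def real_sqrt_divide)
    have E: "0 \<le> E" "E \<le> 1" using p_bounds by (auto simp: E_def)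
    \<comment> \<open>One factor \<open>\<bar>t\<bar>\<close> is kept in every error term, the
      others are bounded by \<open>T\<close>.\<close>
    have tT: "t\<^sup>2 \<le> \<bar>t\<bar> * T"
      using mult_left_mono[OF t, of "\<bar>t\<bar>"] by (simp add: power2_eq_square abs_mult_self_eq)
    have A: "cmod (chf (Suc n) \<theta> - chf n (t * \<rho> n / sqrt (real n)) * E)
        \<le> (T * m\<^sup>2 / (real n + 1) * \<eta> n + T\<^sup>2 * \<bar>m\<bar> ^ 3 / sqrt (real n + 1) ^ 3) * \<bar>t\<bar>"
    proof -
      have "cmod (chf (Suc n) \<theta> - chf n (t * \<rho> n / sqrt (real n)) * E) \<le> (\<theta> * m)\<^sup>2 * \<eta> n + \<bar>\<theta> * m\<bar> ^ 3"
        using chf_step[OF \<theta>m, of n] unfolding \<theta>\<rho> \<eta>_def E_def .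
      also have "(\<theta> * m)\<^sup>2 * \<eta> n \<le> (\<bar>t\<bar> * T) * (m\<^sup>2 / (real n + 1)) * \<eta> n"
        unfolding \<theta>2 using \<eta>0[of n] by (intro mult_right_mono tT) auto
      also have "\<bar>\<theta> * m\<bar> ^ 3 \<le> (\<bar>t\<bar> * T\<^sup>2) * (\<bar>m\<bar> ^ 3 / sqrt (real n + 1) ^ 3)"
      proof -
        have "\<bar>t\<bar> ^ 3 = \<bar>t\<bar> * \<bar>t\<bar>\<^sup>2" by (simp add: power3_eq_cube power2_eq_square)
        also have "\<dots> \<le> \<bar>t\<bar> * T\<^sup>2" using t by (intro mult_left_mono power_mono) auto
        finally have "\<bar>t\<bar> ^ 3 * (\<bar>m\<bar> ^ 3 / sqrt (real n + 1) ^ 3)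
            \<le> (\<bar>t\<bar> * T\<^sup>2) * (\<bar>m\<bar> ^ 3 / sqrt (real n + 1) ^ 3)"
          by (rule mult_right_mono) auto
        then show ?thesis by (simp add: \<theta>_def abs_mult power_mult_distrib power_divide)
      qed
      finally show ?thesis by (simp add: algebra_simps)
    qed
    have B: "cmod ((chf n (t * \<rho> n / sqrt (real n)) - g (t * \<rho> n)) * E) \<le> \<rho> n * y * \<bar>t\<bar>"
    proof -
      have "\<bar>t * \<rho> n\<bar> \<le> \<bar>t\<bar> * 1" unfolding abs_mult using n by (intro mult_left_mono) auto
      then have "\<bar>t * \<rho> n\<bar> \<le> T" using t by simp
      from IH[OF this] have *: "cmod (chf n (t * \<rho> n / sqrt (real n)) - g (t * \<rho> n)) \<le> \<rho> n * y * \<bar>t\<bar>"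
        using n by (simp add: abs_mult mult_ac)
      then have "cmod (chf n (t * \<rho> n / sqrt (real n)) - g (t * \<rho> n)) * E \<le> \<rho> n * y * \<bar>t\<bar> * 1"
        using E by (intro mult_mono order_trans[OF norm_ge_zero *]) auto
      then show ?thesis using E by (simp add: norm_mult)
    qed
    have C: "cmod (of_real (g (t * \<rho> n) * E - g t)) \<le> T / 2 * \<bar>v * (1 - (\<rho> n)\<^sup>2) - k / (real n + 1)\<bar> * \<bar>t\<bar>"
    proof -
      have k\<theta>: "(\<theta> * m)\<^sup>2 * (p * (1 - p)) = t\<^sup>2 * (k / (real n + 1))"
        unfolding \<theta>2 k_def by simp
      have "\<bar>g (t * \<rho> n) * E - g t\<bar>
        = \<bar>exp (- (v * (t * \<rho> n)\<^sup>2 / 2 + t\<^sup>2 * (k / (real n + 1)) / 2)) - exp (- (v * t\<^sup>2 / 2))\<bar>"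
        unfolding g_def E_def k\<theta> by (simp flip: exp_add)
      also have "\<dots> \<le> \<bar>v * (t * \<rho> n)\<^sup>2 / 2 + t\<^sup>2 * (k / (real n + 1)) / 2 - v * t\<^sup>2 / 2\<bar>"
        using v k by (intro abs_exp_neg_diff_le) auto
      also have "v * (t * \<rho> n)\<^sup>2 / 2 + t\<^sup>2 * (k / (real n + 1)) / 2 - v * t\<^sup>2 / 2
        = - (t\<^sup>2 / 2 * (v * (1 - (\<rho> n)\<^sup>2) - k / (real n + 1)))"
        by (simp add: power_mult_distrib field_simps)
      also have "\<bar>\<dots>\<bar> = t\<^sup>2 * (\<bar>v * (1 - (\<rho> n)\<^sup>2) - k / (real n + 1)\<bar> / 2)"
        by (simp add: abs_mult)
      also have "\<dots> \<le> (\<bar>t\<bar> * T) * (\<bar>v * (1 - (\<rho> n)\<^sup>2) - k / (real n + 1)\<bar> / 2)"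
        by (intro mult_right_mono tT) auto
      finally show ?thesis unfolding norm_of_real by (simp add: mult_ac)
    qed
    \<comment> \<open>The three differences are the one-step expansion error, the inherited error at
      the argument \<open>t * \<rho> n\<close>, and the fixed-point defect of the Gaussian.\<close>
    have split: "chf (Suc n) \<theta> - g t = (chf (Suc n) \<theta> - chf n (t * \<rho> n / sqrt (real n)) * E)
        + (chf n (t * \<rho> n / sqrt (real n)) - g (t * \<rho> n)) * E + of_real (g (t * \<rho> n) * E - g t)"
      by (simp add: algebra_simps)
    have "cmod (chf (Suc n) \<theta> - g t) \<le>
        (T * m\<^sup>2 / (real n + 1) * \<eta> n + T\<^sup>2 * \<bar>m\<bar> ^ 3 / sqrt (real n + 1) ^ 3) * \<bar>t\<bar>
        + \<rho> n * y * \<bar>t\<bar> + T / 2 * \<bar>v * (1 - (\<rho> n)\<^sup>2) - k / (real n + 1)\<bar> * \<bar>t\<bar>"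
      unfolding split by (intro order_trans[OF norm_triangle_ineq] add_mono A B C)
    then show ?thesis by (simp add: e_def \<theta>_def algebra_simps)
  qed
  \<comment> \<open>From some index on, \<open>chf_step\<close> applies to all arguments in the
    interval, and multiplication by \<open>\<rho> n\<close> does not leave the interval.\<close>
  have "\<forall>\<^sub>F n in sequentially. real n * (1 - \<rho> n) > 0"
    by (rule order_tendstoD(1)[OF \<rho>_lim]) (use small in simp)
  moreover have "\<forall>\<^sub>F n in sequentially. T * \<bar>m\<bar> / sqrt (real n + 1) < 1"
    by (rule order_tendstoD(2)[of _ 0]) (real_asymp, simp)
  moreover have "\<forall>\<^sub>F n in sequentially. \<rho> n > 0"
    by (rule order_tendstoD(1)[OF \<rho>_1]) simp
  ultimately have "\<forall>\<^sub>F n in sequentially. n > 0 \<and> T * \<bar>m\<bar> / sqrt (real n + 1) \<le> 1 \<and> 0 \<le> \<rho> n \<and> \<rho> n \<le> 1"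
    using eventually_gt_at_top[of 0] by eventually_elim (auto simp: zero_less_mult_iff)
  then obtain n0 where n0: "\<And>n. n \<ge> n0 \<Longrightarrow> n > 0 \<and> T * \<bar>m\<bar> / sqrt (real n + 1) \<le> 1 \<and> 0 \<le> \<rho> n \<and> \<rho> n \<le> 1"
    by (auto simp: eventually_sequentially)
  \<comment> \<open>The two summands bound, relative to the argument, the distances of
    \<open>chf n0\<close> and of \<open>g\<close> from 1.\<close>
  define K where "K = urn_size n0 + v * T / 2"
  \<comment> \<open>The constant values up to \<open>n0\<close> serve to start the recursion with
    \<open>y n0 = K\<close>.\<close>
  define y where "y = rec_nat K (\<lambda>n r. if n < n0 then K else \<rho> n * r + e n)"
  have y_Suc: "y (Suc n) = (if n < n0 then K else \<rho> n * y n + e n)" for n by (simp add: y_def)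
  have y_n0: "y n0 = K" by (cases n0) (auto simp: y_def)
  have K: "K \<ge> 0" using urn_size_ge_1[of n0] v T by (simp add: K_def)
  have y0: "0 \<le> y n" for n
  proof (induction n)
    case 0
    then show ?case using K by (simp add: y_def)
  next
    case (Suc n)
    then show ?case using K e0[of n] n0[of n] by (auto simp: y_Suc)
  qed
  have bound: "cmod (chf n (x / sqrt (real n)) - g x) \<le> y n * \<bar>x\<bar>" if "n \<ge> n0" "\<bar>x\<bar> \<le> T" for n x
    using that
  proof (induction n arbitrary: x rule: dec_induct)
    case base
    have "sqrt (real n0) \<ge> 1" using n0[of n0] by simp
    then have "\<bar>x\<bar> * urn_size n0 / sqrt (real n0) \<le> \<bar>x\<bar> * urn_size n0 / 1"
      using urn_size_ge_1[of n0] by (intro divide_left_mono) auto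
    then have "cmod (chf n0 (x / sqrt (real n0)) - 1) \<le> \<bar>x\<bar> * urn_size n0"
      using chf_near_1[of n0 "x / sqrt (real n0)"] by simp
    moreover have "cmod (1 - of_real (g x)) \<le> v * T / 2 * \<bar>x\<bar>"
    proof -
      have "\<bar>1 - g x\<bar> \<le> v * x\<^sup>2 / 2" using abs_exp_neg_diff_le[of 0 "v * x\<^sup>2 / 2"] v by (simp add: g_def)
      also have "\<dots> = v * (\<bar>x\<bar> * \<bar>x\<bar>) / 2" by (simp add: power2_eq_square)
      also have "\<dots> \<le> v * (T * \<bar>x\<bar>) / 2"
        using base v by (intro divide_right_mono mult_left_mono mult_right_mono) auto
      finally have "\<bar>1 - g x\<bar> \<le> v * T / 2 * \<bar>x\<bar>" by simp
      then have "cmod (of_real (1 - g x)) \<le> v * T / 2 * \<bar>x\<bar>" unfolding norm_of_real .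
      then show ?thesis by simp
    qed
    ultimately have "cmod (chf n0 (x / sqrt (real n0)) - g x) \<le> \<bar>x\<bar> * urn_size n0 + v * T / 2 * \<bar>x\<bar>"
      by (rule norm_diff_triangle_le)
    then show ?case by (simp add: y_n0 K_def algebra_simps)
  next
    case (step n)
    have n: "n > 0" "T * \<bar>m\<bar> / sqrt (real n + 1) \<le> 1" "0 \<le> \<rho> n" "\<rho> n \<le> 1"
      using n0[OF step.hyps(1)] by auto
    show ?case
      using recursion[OF n step.prems step.IH] step.hyps by (simp add: y_Suc)
  qed
  have "y \<longlonglongrightarrow> 0"
  proof (rule contraction_tendsto_0[OF _ y0 \<rho>_lim _ e_lim])
    show "\<forall>\<^sub>F n in sequentially. y (Suc n) \<le> \<rho> n * y n + e n"
      using eventually_ge_at_top[of n0] by eventually_elim (simp add: y_Suc)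
  qed (use small in simp)
  then have lim: "(\<lambda>n. y n * \<bar>t\<bar>) \<longlonglongrightarrow> 0" by (rule tendsto_mult_left_zero)
  have "(\<lambda>n. chf n (t / sqrt (real n)) - of_real (g t)) \<longlonglongrightarrow> 0"
    by (rule Lim_null_comparison[OF _ lim])
      (use bound[OF _ T(2)] in \<open>auto simp: eventually_sequentially\<close>)
  then show ?thesis unfolding LIM_zero_iff by (simp add: g_def v_def exp_of_real)
qed

end

section \<open>From convergence on the real line to convergence along a line in space\<close>

text \<open>The Skorohod representation turns weak convergence of the scalar coordinate into
  pointwise convergence. The vanishing shift \<open>r\<close> is then absorbed by continuity, and
  dominated convergence applies to the bounded test function.\<close>

lemma converges_in_distribution_line:
  fixes X :: "nat \<Rightarrow> 'a \<Rightarrow> real" and w :: "'b :: euclidean_space" and r :: "nat \<Rightarrow> 'b"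
  assumes M: "prob_space M" and X [measurable]: "\<And>n. X n \<in> borel_measurable M"
    and \<nu>: "real_distribution \<nu>"
    and conv: "weak_conv_m (\<lambda>n. distr M borel (X n)) \<nu>"
    and r: "r \<longlonglongrightarrow> 0"
    and Z: "\<And>n \<omega>. \<omega> \<in> space M \<Longrightarrow> Z n \<omega> = X n \<omega> *\<^sub>R w + r n"
  shows "converges_in_distribution M Z (distr \<nu> borel (\<lambda>x. x *\<^sub>R w))"
  unfolding converges_in_distribution_def converges_weakly_def
proof (intro allI impI)
  fix f :: "'b \<Rightarrow> real" assume f: "continuous_on UNIV f" and "bounded (range f)"
  then obtain B where B: "\<And>x. norm (f x) \<le> B" by (auto simp: bounded_iff)
  have [measurable]: "f \<in> borel_measurable borel" using f by (rule borel_measurable_continuous_onI)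
  interpret prob_space M by fact
  interpret \<nu>: real_distribution \<nu> by fact
  have rd: "real_distribution (distr M borel (X n))" for n by (rule real_distribution_distr) simp
  from Skorohod[OF rd \<nu> conv] obtain \<Omega> :: "real measure" and Ys Y where
    sk: "prob_space \<Omega> \<and> (\<forall>n. Ys n \<in> measurable \<Omega> borel) \<and>
      (\<forall>n. distr \<Omega> borel (Ys n) = distr M borel (X n)) \<and> Y \<in> measurable \<Omega> lborel \<and>
      distr \<Omega> borel Y = \<nu> \<and> (\<forall>x \<in> space \<Omega>. (\<lambda>n. Ys n x) \<longlonglongrightarrow> Y x)" by blast
  then have \<Omega>: "prob_space \<Omega>" and [measurable]: "\<And>n. Ys n \<in> borel_measurable \<Omega>"
    and dYs: "\<And>n. distr \<Omega> borel (Ys n) = distr M borel (X n)"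
    and [measurable]: "Y \<in> borel_measurable \<Omega>" and dY: "distr \<Omega> borel Y = \<nu>"
    and lim: "\<And>x. x \<in> space \<Omega> \<Longrightarrow> (\<lambda>n. Ys n x) \<longlonglongrightarrow> Y x" by simp_all
  interpret \<Omega>: prob_space \<Omega> by fact
  have "(\<lambda>n. LINT x|\<Omega>. f (Ys n x *\<^sub>R w + r n)) \<longlonglongrightarrow> (LINT x|\<Omega>. f (Y x *\<^sub>R w))"
  proof (rule integral_dominated_convergence[where w="\<lambda>_. B"])
    show "AE x in \<Omega>. (\<lambda>n. f (Ys n x *\<^sub>R w + r n)) \<longlonglongrightarrow> f (Y x *\<^sub>R w)"
    proof (rule AE_I2)
      fix x assume "x \<in> space \<Omega>"
      have "(\<lambda>n. Ys n x *\<^sub>R w + r n) \<longlonglongrightarrow> Y x *\<^sub>R w + 0"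
        by (intro tendsto_intros lim r) fact
      then show "(\<lambda>n. f (Ys n x *\<^sub>R w + r n)) \<longlonglongrightarrow> f (Y x *\<^sub>R w)"
        using f by (intro continuous_on_tendsto_compose[OF f]) auto
    qed
  qed (use B in auto)
  also have "(\<lambda>n. LINT x|\<Omega>. f (Ys n x *\<^sub>R w + r n)) = (\<lambda>n. LINT x|distr \<Omega> borel (Ys n). f (x *\<^sub>R w + r n))"
    by (simp add: integral_distr)
  also have "\<dots> = (\<lambda>n. LINT \<omega>|M. f (X n \<omega> *\<^sub>R w + r n))"
    unfolding dYs by (simp add: integral_distr)
  also have "\<dots> = (\<lambda>n. LINT x|distr M borel (Z n). f x)"
  proof
    fix n
    \<comment> \<open>The formula for \<open>Z n\<close> is available on the space of
      \<open>M\<close> only, so measurability is transferred by congruence.\<close>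
    have "Z n \<in> borel_measurable M \<longleftrightarrow> (\<lambda>\<omega>. X n \<omega> *\<^sub>R w + r n) \<in> borel_measurable M"
      by (rule measurable_cong) (rule Z)
    then have [measurable]: "Z n \<in> borel_measurable M" by simp
    show "(LINT \<omega>|M. f (X n \<omega> *\<^sub>R w + r n)) = (LINT x|distr M borel (Z n). f x)"
      by (subst integral_distr) (auto intro!: Bochner_Integration.integral_cong simp: Z)
  qed
  also have "(LINT x|\<Omega>. f (Y x *\<^sub>R w)) = (LINT x|distr \<Omega> borel Y. f (x *\<^sub>R w))"
    by (simp add: integral_distr)
  also have "\<dots> = (LINT x|distr \<nu> borel (\<lambda>x. x *\<^sub>R w). f x)"
    unfolding dY by (simp add: integral_distr)
  finally show "(\<lambda>n. LINT x|distr M borel (Z n). f x) \<longlonglongrightarrow> (LINT x|distr \<nu> borel (\<lambda>x. x *\<^sub>R w). f x)" .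
qed

section \<open>The Gaussian limit and the theorem for the composition vector\<close>

text \<open>Writing the limit as the image of a standard normal law includes \<open>s = 0\<close>,
  the point mass at 0 that arises when a = c.\<close>

lemma real_distribution_scaled_normal:
  "real_distribution (distr std_normal_distribution borel (\<lambda>x. s * x))"
  by (intro prob_space.real_distribution_distr)
     (auto simp: real_dist_normal_dist real_distribution.axioms)

lemma char_scaled_normal:
  "char (distr std_normal_distribution borel (\<lambda>x. s * x)) t = exp (- (s\<^sup>2 * t\<^sup>2 / 2))"
proof -
  have "char (distr std_normal_distribution borel (\<lambda>x. s * x)) t = char std_normal_distribution (t * s)"
    by (simp add: char_def integral_distr mult_ac)
  then show ?thesis
    by (simp add: char_std_normal_distribution power_mult_distrib mult_ac exp_of_real)
qed

theorem theorem3p4: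
  fixes M :: "'a measure" and F :: "nat \<Rightarrow> 'a measure"
    and a b c d S \<alpha> \<beta> :: nat
    and red :: "nat \<Rightarrow> 'a \<Rightarrow> bool" and U :: "nat \<Rightarrow> 'a \<Rightarrow> real^2"
    and m \<sigma> :: real and v1 :: "real^2" and \<Gamma> :: "real^2^2"
  assumes urn: "balanced_polya_urn M F a b c d S \<alpha> \<beta> red U"
    and m: "m = real a - real c"
    and \<sigma>: "\<sigma> = m / real S"
    and v1: "v1 = (real S / real (b + c)) *\<^sub>R vector [real c, real b]"
    and \<Gamma>: "\<Gamma> = (1 / (1 - 2 * \<sigma>) * (real b * real c * m\<^sup>2 / (real (b + c))\<^sup>2)) *\<^sub>R
               vector [vector [1, -1], vector [-1, 1]]"
    and small: "\<sigma> < 1 / 2"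
    and bc: "b * c \<noteq> 0"
  shows "\<exists>N. gaussian_law 0 \<Gamma> N \<and>
    converges_in_distribution M (\<lambda>n \<omega>. (1 / sqrt (real n)) *\<^sub>R (U n \<omega> - real n *\<^sub>R v1)) N"
proof -
  interpret urn: balanced_polya_urn M F a b c d S \<alpha> \<beta> red U by fact
  have m_eq: "urn.m = m" by (simp add: urn.m_def m)
  have sm: "urn.m / real S < 1 / 2" using small by (simp add: m_eq \<sigma>)
  define p where "p = urn.p"
  have bc0: "real b + real c > 0" using bc by (cases b) auto
  have p: "p = real c / (real b + real c)" "1 - p = real b / (real b + real c)"
    using bc0 by (simp_all add: p_def urn.p_def field_simps)
  define v where "v = urn.asymp_var"
  have v: "v = 1 / (1 - 2 * \<sigma>) * (real b * real c * m\<^sup>2 / (real (b + c))\<^sup>2)"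
    unfolding v_def urn.asymp_var_def p_def[symmetric] m_eq \<sigma> p(2) unfolding p(1)
    by (simp add: power2_eq_square mult_ac)
  have v0: "v \<ge> 0" unfolding v using small by simp
  \<comment> \<open>The total number of balls is deterministic, so all fluctuations have this
    direction.\<close>
  define w :: "real^2" where "w = vector [1, -1]"
  define \<nu> where "\<nu> = distr std_normal_distribution borel (\<lambda>x. sqrt v * x)"
  define X where "X n \<omega> = urn.W n \<omega> / sqrt (real n)" for n \<omega>
  \<comment> \<open>The centring of \<open>W\<close> uses the full urn size, whereas
    \<open>n *\<^sub>R v1\<close> leaves out the initial balls; \<open>r\<close> is their rescaled
    share.\<close>
  define r :: "nat \<Rightarrow> real^2" where
    "r n = (1 / sqrt (real n)) *\<^sub>R (real (\<alpha> + \<beta>) *\<^sub>R vector [p, 1 - p])" for n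
  have \<nu>: "real_distribution \<nu>" unfolding \<nu>_def by (rule real_distribution_scaled_normal)
  interpret \<nu>: real_distribution \<nu> by fact
  have char_\<nu>: "char \<nu> t = exp (- (v * t\<^sup>2 / 2))" for t
    unfolding \<nu>_def char_scaled_normal using v0 by simp
  have [measurable]: "X n \<in> borel_measurable M" for n unfolding X_def by measurable
  have conv: "weak_conv_m (\<lambda>n. distr M borel (X n)) \<nu>"
  proof (rule levy_continuity[OF _ \<nu>])
    fix t
    have "char (distr M borel (X n)) t = urn.chf n (t / sqrt (real n))" for n
      by (simp add: char_def integral_distr urn.chf_def X_def)
    then show "(\<lambda>n. char (distr M borel (X n)) t) \<longlonglongrightarrow> char \<nu> t"
      using urn.chf_tendsto[OF sm, of t] by (simp add: char_\<nu> v_def)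
  qed (simp add: urn.real_distribution_distr)
  have r: "r \<longlonglongrightarrow> 0"
  proof -
    have "(\<lambda>n. 1 / sqrt (real n)) \<longlonglongrightarrow> 0" by real_asymp
    from tendsto_scaleR[OF this tendsto_const[of "real (\<alpha> + \<beta>) *\<^sub>R vector [p, 1 - p] :: real^2"]]
    show ?thesis by (simp add: r_def[abs_def])
  qed
  \<comment> \<open>The identity also holds at n = 0, where division by zero makes both sides
    0.\<close>
  have Z: "(1 / sqrt (real n)) *\<^sub>R (U n \<omega> - real n *\<^sub>R v1) = X n \<omega> *\<^sub>R w + r n"
    if \<omega>: "\<omega> \<in> space M" for n \<omega>
  proof -
    have v1': "v1 = real S *\<^sub>R vector [p, 1 - p]"
      unfolding v1 p(2) unfolding p(1) by (simp add: vec_eq_iff forall_2)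
    have 1: "U n \<omega> $ 1 = urn.W n \<omega> + p * (real (\<alpha> + \<beta>) + real n * real S)"
      by (simp add: urn.W_def urn.urn_size_def p_def)
    have 2: "U n \<omega> $ 2 = (real (\<alpha> + \<beta>) + real n * real S) - U n \<omega> $ 1"
      using urn.U_sum[OF \<omega>, of n] by (simp add: urn.urn_size_def)
    have "U n \<omega> - real n *\<^sub>R v1 = urn.W n \<omega> *\<^sub>R w + real (\<alpha> + \<beta>) *\<^sub>R vector [p, 1 - p]"
      unfolding v1' w_def by (simp add: vec_eq_iff forall_2 2 1 algebra_simps)
    then show ?thesis by (simp add: X_def r_def scaleR_add_right)
  qed
  \<comment> \<open>The matrix \<open>\<Gamma>\<close> is \<open>v\<close> times the outer product
    of \<open>w\<close> with itself, so a centred normal variable of variance \<open>v\<close> times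
    \<open>w\<close> has this covariance.\<close>
  define N where "N = distr \<nu> borel (\<lambda>x. x *\<^sub>R w)"
  have "gaussian_law 0 \<Gamma> N"
    unfolding gaussian_law_def
  proof (intro conjI allI)
    show "prob_space N" unfolding N_def by (rule \<nu>.prob_space_distr) simp
    show "sets N = sets borel" by (simp add: N_def)
    fix u :: "real^2"
    have "u \<bullet> w = u $ 1 - u $ 2" by (simp add: w_def inner_vec_def sum_2)
    moreover have "u \<bullet> (\<Gamma> *v u) = v * (u $ 1 - u $ 2)\<^sup>2"
      unfolding \<Gamma> v[symmetric]
      by (simp add: inner_vec_def matrix_vector_mult_def sum_2 power2_eq_square algebra_simps)
    moreover have "(LINT x|N. iexp (u \<bullet> x)) = char \<nu> (u \<bullet> w)"
      by (simp add: N_def integral_distr char_def mult.commute)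
    ultimately show "(LINT x|N. iexp (u \<bullet> x)) = exp (\<i> * of_real (u \<bullet> 0) - of_real (u \<bullet> (\<Gamma> *v u)) / 2)"
      by (simp add: char_\<nu> flip: exp_of_real)
  qed
  moreover have "converges_in_distribution M (\<lambda>n \<omega>. (1 / sqrt (real n)) *\<^sub>R (U n \<omega> - real n *\<^sub>R v1)) N"
    unfolding N_def by (rule converges_in_distribution_line[OF urn.prob_space_axioms _ \<nu> conv r Z]) simp_all
  ultimately show ?thesis by blast
qed

end
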